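(* Let $V^*$ be the Lie algebra over $\mathbb{F}=\mathbb{F}_2$, $\mathcal{U},\mathcal{V},\mathcal{W}\leq \mathrm{GL}(V^* )$ the subgroups, and $G=\langle 1+\mathrm{ad}(x),\mathcal{U},\mathcal{V},\mathcal{W}\rangle\leq \mathrm{GL}(V^* )$ the group defined in the context. The element $1+\mathrm{ad}(x)$ is a left $3$-Engel element in $G$. However, the normal closure $\langle 1+\mathrm{ad}(x)\rangle^{G}$ of $1+\mathrm{ad}(x)$ in $G$ is not nilpotent.
   Context: Left Engel elements: an element $a$ of a group $G$ is a left $n$-Engel element in $G$ if $[[\ldots[[g,a],a],\ldots],a]=1$ (with $n$ occurrences of $a$) for every $g\in G$, where $[g,h]=g^{-1}h^{-1}gh$. Let $\mathbb{F}$ be the field with $2$ elements, and let $V=\mathbb{F}x+\mathbb{F}u+\mathbb{F}v+\mathbb{F}w$ be the $4$-dimensional Lie algebra with basis $x,u,v,w$ whose (bilinear, alternating, hence in characteristic $2$ symmetric) product is given by $$u\cdot v=u,\quad v\cdot w=w,\quad w\cdot u=v,\quad u\cdot x=0,\quad v\cdot x=0,\quad w\cdot x=u.$$ Let $W=\mathbb{F}u+\mathbb{F}v+\mathbb{F}w$, an ideal of $V$. For $A,B\subseteq\mathbb{N}$ put $A\sqcup B=A\cup B$ if $A\cap B=\emptyset$ and $A\sqcup B=\emptyset$ otherwise. For each non-empty $A\subseteq\mathbb{N}$ let $W_A=\{z_A: z\in W\}$ be a copy of the vector space $W$, with $z_A+t_A=(z+t)_A$, and interpret $z_\emptyset=0$.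 Let $W^*=\bigoplus_{\emptyset\neq A\subseteq\mathbb{N}}W_A$, a Lie algebra with product determined by $z_A\cdot t_B=(z\cdot t)_{A\sqcup B}$ for non-empty $A,B$. Let $V^*=W^*\oplus\mathbb{F}x$ be the semidirect product in which $z_A\cdot x=(z\cdot x)_A$. Thus $V^*$ has basis $\{x\}\cup\{u_A,v_A,w_A:\emptyset\neq A\subseteq\mathbb{N}\}$. For $y\in V^*$, $\mathrm{ad}(y)$ is the linear operator $z\mapsto z\cdot y$ on $V^*$. Operators act on the right, so a product $fg$ means first $f$, then $g$. Each of $1+\mathrm{ad}(x)$, $1+\mathrm{ad}(u_A)$, $1+\mathrm{ad}(v_A)$, $1+\mathrm{ad}(w_A)$ is invertible with square $1$. Put $$\mathcal{U}=\langle 1+\mathrm{ad}(u_A)\rangle,\quad \mathcal{V}=\langle 1+\mathrm{ad}(v_A)\rangle,\quad \mathcal{W}=\langle 1+\mathrm{ad}(w_A)\rangle,$$ where $A$ runs over the non-empty subsets of $\mathbb{N}$, and $G=\langle 1+\mathrm{ad}(x),\mathcal{U},\mathcal{V},\mathcal{W}\rangle\leq\mathrm{GL}(V^* )$. *)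

theory Defs
  imports
    "HOL-Library.Z2"
    "HOL-Library.Poly_Mapping"
    "HOL-Algebra.Algebra"
begin

definition commutator :: "('a, 'b) monoid_scheme \<Rightarrow> 'a \<Rightarrow> 'a \<Rightarrow> 'a" where
  "commutator G g h = inv\<^bsub>G\<^esub> g \<otimes>\<^bsub>G\<^esub> inv\<^bsub>G\<^esub> h \<otimes>\<^bsub>G\<^esub> g \<otimes>\<^bsub>G\<^esub> h"

definition left_Engel :: "nat \<Rightarrow> ('a, 'b) monoid_scheme \<Rightarrow> 'a \<Rightarrow> bool" where
  "left_Engel n G a \<longleftrightarrow>
     a \<in> carrier G \<and> (\<forall>g\<in>carrier G. ((\<lambda>z. commutator G z a) ^^ n) g = \<one>\<^bsub>G\<^esub>)"

definition normal_closure :: "('a, 'b) monoid_scheme \<Rightarrow> 'a set \<Rightarrow> 'a set" where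
  "normal_closure G S =
     generate G {inv\<^bsub>G\<^esub> g \<otimes>\<^bsub>G\<^esub> s \<otimes>\<^bsub>G\<^esub> g | s g. s \<in> S \<and> g \<in> carrier G}"

primrec lower_central :: "('a, 'b) monoid_scheme \<Rightarrow> nat \<Rightarrow> 'a set" where
  "lower_central G 0 = carrier G"
| "lower_central G (Suc n) =
     generate G {commutator G a b | a b. a \<in> lower_central G n \<and> b \<in> carrier G}"

definition nilpotent_group :: "('a, 'b) monoid_scheme \<Rightarrow> bool" where
  "nilpotent_group G \<longleftrightarrow> (\<exists>n. lower_central G n = {\<one>\<^bsub>G\<^esub>})"

definition scale :: "bit \<Rightarrow> ('i \<Rightarrow>\<^sub>0 bit) \<Rightarrow> ('i \<Rightarrow>\<^sub>0 bit)" where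
  "scale c = Poly_Mapping.map ((*) c)"

abbreviation bas :: "'i \<Rightarrow> ('i \<Rightarrow>\<^sub>0 bit)" where
  "bas i \<equiv> Poly_Mapping.single i 1"

definition bilinear_ext ::
    "('i \<Rightarrow> 'i \<Rightarrow> ('i \<Rightarrow>\<^sub>0 bit)) \<Rightarrow> ('i \<Rightarrow>\<^sub>0 bit) \<Rightarrow> ('i \<Rightarrow>\<^sub>0 bit) \<Rightarrow> ('i \<Rightarrow>\<^sub>0 bit)" where
  "bilinear_ext t y z =
     (\<Sum>i\<in>Poly_Mapping.keys y. \<Sum>j\<in>Poly_Mapping.keys z.
        scale (Poly_Mapping.lookup y i * Poly_Mapping.lookup z j) (t i j))"

interpretation bit_vs: vector_space "scale :: bit \<Rightarrow> ('i \<Rightarrow>\<^sub>0 bit) \<Rightarrow> _"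
  by unfold_locales
    (auto simp: scale_def poly_mapping_eq_iff fun_eq_iff map.rep_eq lookup_add algebra_simps when_def)

datatype W_index = U_i | V_i | W_i

datatype V_index = X_i | of_W W_index

type_synonym V_alg = "V_index \<Rightarrow>\<^sub>0 bit"

abbreviation xV :: V_alg where "xV \<equiv> bas X_i"
abbreviation uV :: V_alg where "uV \<equiv> bas (of_W U_i)"
abbreviation vV :: V_alg where "vV \<equiv> bas (of_W V_i)"
abbreviation wV :: V_alg where "wV \<equiv> bas (of_W W_i)"

fun V_table :: "V_index \<Rightarrow> V_index \<Rightarrow> V_alg" where
  "V_table (of_W U_i) (of_W V_i) = uV"
| "V_table (of_W V_i) (of_W U_i) = uV"
| "V_table (of_W V_i) (of_W W_i) = wV"
| "V_table (of_W W_i) (of_W V_i) = wV"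
| "V_table (of_W W_i) (of_W U_i) = vV"
| "V_table (of_W U_i) (of_W W_i) = vV"
| "V_table (of_W W_i) X_i = uV"
| "V_table X_i (of_W W_i) = uV"
| "V_table _ _ = 0"

definition V_prod :: "V_alg \<Rightarrow> V_alg \<Rightarrow> V_alg" where
  "V_prod = bilinear_ext V_table"

definition W_sub :: "V_alg set" where
  "W_sub = {z. Poly_Mapping.lookup z X_i = 0}"

typedef nonempty_set = "{A :: nat set. A \<noteq> {}}"
  morphisms set_of nonempty_of
  by blast

text \<open>The index of the basis vector x, and the indices of the basis vectors
  \<open>u_A\<close>, \<open>v_A\<close>, \<open>w_A\<close> for nonempty \<open>A\<close>.\<close>

datatype Vstar_index = Xs | Copy W_index nonempty_set

type_synonym Vstar = "Vstar_index \<Rightarrow>\<^sub>0 bit"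

text \<open>\<open>copy z A\<close> is the element \<open>z_A\<close> of V*, for z in W. It is only meant for
  z in \<^const>\<open>W_sub\<close>; the x-coordinate of z is ignored.\<close>

definition copy :: "V_alg \<Rightarrow> nat set \<Rightarrow> Vstar" where
  "copy z A =
     (if A = {} then 0
      else (\<Sum>i\<in>{U_i, V_i, W_i}.
              Poly_Mapping.single (Copy i (nonempty_of A)) (Poly_Mapping.lookup z (of_W i))))"

definition sq_union :: "nat set \<Rightarrow> nat set \<Rightarrow> nat set" (infixl \<open>\<squnion>\<^sub>d\<close> 65) where
  "A \<squnion>\<^sub>d B = (if A \<inter> B = {} then A \<union> B else {})"

fun Vstar_table :: "Vstar_index \<Rightarrow> Vstar_index \<Rightarrow> Vstar" where
  "Vstar_table (Copy i A) (Copy j B) =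
     copy (V_prod (bas (of_W i)) (bas (of_W j))) (set_of A \<squnion>\<^sub>d set_of B)"
| "Vstar_table (Copy i A) Xs = copy (V_prod (bas (of_W i)) xV) (set_of A)"
| "Vstar_table Xs (Copy j B) = copy (V_prod xV (bas (of_W j))) (set_of B)"
| "Vstar_table Xs Xs = 0"

definition Vstar_prod :: "Vstar \<Rightarrow> Vstar \<Rightarrow> Vstar" where
  "Vstar_prod = bilinear_ext Vstar_table"

abbreviation x_star :: Vstar where "x_star \<equiv> bas Xs"

definition ad :: "Vstar \<Rightarrow> Vstar \<Rightarrow> Vstar" where
  "ad y = (\<lambda>z. Vstar_prod z y)"

definition one_plus_ad :: "Vstar \<Rightarrow> Vstar \<Rightarrow> Vstar" where
  "one_plus_ad y = (\<lambda>z. z + ad y z)"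

text \<open>Operators act on the right: the product of f and g is first f, then g.\<close>

definition GL_Vstar :: "(Vstar \<Rightarrow> Vstar) monoid" where
  "GL_Vstar = \<lparr>carrier = {f. Vector_Spaces.linear scale scale f \<and> bij f},
               monoid.mult = (\<lambda>f g. g \<circ> f), one = id\<rparr>"

definition U_grp :: "(Vstar \<Rightarrow> Vstar) set" where
  "U_grp = generate GL_Vstar {one_plus_ad (copy uV A) | A. A \<noteq> {}}"

definition V_grp :: "(Vstar \<Rightarrow> Vstar) set" where
  "V_grp = generate GL_Vstar {one_plus_ad (copy vV A) | A. A \<noteq> {}}"

definition W_grp :: "(Vstar \<Rightarrow> Vstar) set" where
  "W_grp = generate GL_Vstar {one_plus_ad (copy wV A) | A. A \<noteq> {}}"

definition G_grp :: "(Vstar \<Rightarrow> Vstar) monoid" where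
  "G_grp = GL_Vstar\<lparr>carrier :=
     generate GL_Vstar ({one_plus_ad x_star} \<union> U_grp \<union> V_grp \<union> W_grp)\<rparr>"

lemma scale_lookup: "Poly_Mapping.lookup (scale c z) i = c * Poly_Mapping.lookup z i"
  by (simp add: scale_def map.rep_eq when_def)

lemma bit_add_self [simp]: "(z :: 'i \<Rightarrow>\<^sub>0 bit) + z = 0"
  by (simp add: poly_mapping_eq_iff fun_eq_iff lookup_add)

lemma bilinear_ext_superset:
  assumes "finite I" "finite J" "Poly_Mapping.keys y \<subseteq> I" "Poly_Mapping.keys z \<subseteq> J"
  shows "bilinear_ext t y z =
    (\<Sum>i\<in>I. \<Sum>j\<in>J. scale (Poly_Mapping.lookup y i * Poly_Mapping.lookup z j) (t i j))"
proof -
  have "(\<Sum>j\<in>Poly_Mapping.keys z. scale (Poly_Mapping.lookup y i * Poly_Mapping.lookup z j) (t i j))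
      = (\<Sum>j\<in>J. scale (Poly_Mapping.lookup y i * Poly_Mapping.lookup z j) (t i j))" for i
    by (rule sum.mono_neutral_left) (use assms in \<open>auto simp: in_keys_iff\<close>)
  moreover have "(\<Sum>i\<in>Poly_Mapping.keys y. \<Sum>j\<in>J. scale (Poly_Mapping.lookup y i * Poly_Mapping.lookup z j) (t i j))
      = (\<Sum>i\<in>I. \<Sum>j\<in>J. scale (Poly_Mapping.lookup y i * Poly_Mapping.lookup z j) (t i j))"
    by (rule sum.mono_neutral_left) (use assms in \<open>auto simp: in_keys_iff\<close>)
  ultimately show ?thesis by (simp add: bilinear_ext_def)
qed

lemma bilinear_ext_add_left: "bilinear_ext t (y + y') z = bilinear_ext t y z + bilinear_ext t y' z"
proof -
  let ?I = "Poly_Mapping.keys y \<union> Poly_Mapping.keys y'"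
  have "Poly_Mapping.keys (y + y') \<subseteq> ?I" by (rule Poly_Mapping.keys_add)
  then show ?thesis
    by (simp add: bilinear_ext_superset[where I = ?I and J = "Poly_Mapping.keys z"]
        lookup_add distrib_right bit_vs.scale_left_distrib sum.distrib del: add_bit_eq_xor mult_bit_eq_and)
qed

lemma bilinear_ext_add_right: "bilinear_ext t y (z + z') = bilinear_ext t y z + bilinear_ext t y z'"
proof -
  let ?J = "Poly_Mapping.keys z \<union> Poly_Mapping.keys z'"
  have "Poly_Mapping.keys (z + z') \<subseteq> ?J" by (rule Poly_Mapping.keys_add)
  then show ?thesis
    by (simp add: bilinear_ext_superset[where J = ?J and I = "Poly_Mapping.keys y"]
        lookup_add distrib_left bit_vs.scale_left_distrib sum.distrib del: add_bit_eq_xor mult_bit_eq_and)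
qed

lemma bilinear_ext_zero [simp]: "bilinear_ext t 0 z = 0" "bilinear_ext t y 0 = 0"
  by (simp_all add: bilinear_ext_def)

lemma bilinear_ext_scale_left: "bilinear_ext t (scale c y) z = scale c (bilinear_ext t y z)"
  by (cases c) simp_all

lemma bilinear_ext_scale_right: "bilinear_ext t y (scale c z) = scale c (bilinear_ext t y z)"
  by (cases c) simp_all

lemma bilinear_ext_bas [simp]: "bilinear_ext t (bas i) (bas j) = t i j"
  by (simp add: bilinear_ext_def)

lemma V_prod_table:
  "V_prod uV vV = uV" "V_prod vV wV = wV" "V_prod wV uV = vV"
  "V_prod uV xV = 0" "V_prod vV xV = 0" "V_prod wV xV = uV"
  by (simp_all add: V_prod_def)

lemma V_index_cases:
  obtains "i = X_i" | "i = of_W U_i" | "i = of_W V_i" | "i = of_W W_i"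
  using V_index.exhaust W_index.exhaust by metis

lemma V_table_alternating: "V_table i i = 0" "V_table i j = V_table j i"
proof -
  show "V_table i i = 0"
    by (cases i rule: V_index_cases) simp_all
  show "V_table i j = V_table j i"
    by (cases i rule: V_index_cases; cases j rule: V_index_cases) simp_all
qed

lemma V_alg_expand:
  "z \<in> W_sub \<Longrightarrow> z = scale (Poly_Mapping.lookup z (of_W U_i)) uV
      + scale (Poly_Mapping.lookup z (of_W V_i)) vV + scale (Poly_Mapping.lookup z (of_W W_i)) wV"
proof (rule poly_mapping_eqI)
  fix k assume "z \<in> W_sub"
  then show "Poly_Mapping.lookup z k = Poly_Mapping.lookup (scale (Poly_Mapping.lookup z (of_W U_i)) uV
      + scale (Poly_Mapping.lookup z (of_W V_i)) vV + scale (Poly_Mapping.lookup z (of_W W_i)) wV) k"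
    by (cases k rule: V_index_cases)
      (simp_all add: lookup_add scale_lookup lookup_single W_sub_def)
qed

lemma W_sub_cases:
  assumes "z \<in> W_sub"
  obtains a b c where "z = scale a uV + scale b vV + scale c wV"
  using V_alg_expand[OF assms] by blast

lemma copy_add: "copy (y + z) A = copy y A + copy z A"
proof (cases "A = {}")
  case False
  then show ?thesis
    by (simp add: copy_def lookup_add Poly_Mapping.single_add sum.distrib del: sum.insert add_bit_eq_xor)
qed (simp add: copy_def)

lemma copy_zero [simp]: "copy 0 A = 0" "copy z {} = 0"
  by (simp_all add: copy_def)

lemma copy_scale: "copy (scale c z) A = scale c (copy z A)"
  by (cases c) simp_all

lemma copy_bas: "A \<noteq> {} \<Longrightarrow> copy (bas (of_W i)) A = bas (Copy i (nonempty_of A))"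
  by (cases i) (simp_all add: copy_def lookup_single)

lemma set_of_nonempty_of [simp]: "A \<noteq> {} \<Longrightarrow> set_of (nonempty_of A) = A"
  by (simp add: nonempty_of_inverse)

lemmas bilinear_ext_linear =
  bilinear_ext_add_left bilinear_ext_add_right bilinear_ext_scale_left bilinear_ext_scale_right

lemma Vstar_prod_copy:
  assumes "z \<in> W_sub" "t \<in> W_sub" "A \<noteq> {}" "B \<noteq> {}"
  shows "Vstar_prod (copy z A) (copy t B) = copy (V_prod z t) (A \<squnion>\<^sub>d B)"
proof -
  obtain a b c where z: "z = scale a uV + scale b vV + scale c wV"
    using assms(1) by (rule W_sub_cases)
  obtain a' b' c' where t: "t = scale a' uV + scale b' vV + scale c' wV"
    using assms(2) by (rule W_sub_cases)
  show ?thesis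
    using assms(3,4)
    by (simp add: z t copy_add copy_scale copy_bas Vstar_prod_def V_prod_def bilinear_ext_linear)
qed

lemma Vstar_prod_copy_x:
  assumes "z \<in> W_sub" "A \<noteq> {}"
  shows "Vstar_prod (copy z A) x_star = copy (V_prod z xV) A"
proof -
  obtain a b c where z: "z = scale a uV + scale b vV + scale c wV"
    using assms(1) by (rule W_sub_cases)
  show ?thesis
    using assms(2)
    by (simp add: z copy_add copy_scale copy_bas Vstar_prod_def V_prod_def bilinear_ext_linear)
qed

lemma Vstar_table_alternating: "Vstar_table i i = 0" "Vstar_table i j = Vstar_table j i"
proof -
  show "Vstar_table i i = 0"
    by (cases i) (simp_all add: V_prod_def V_table_alternating)
  show "Vstar_table i j = Vstar_table j i"
    by (cases i; cases j)
      (simp_all add: V_prod_def sq_union_def Int_commute Un_commute V_table_alternating(2))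
qed

lemma group_GL_Vstar: "group GL_Vstar"
proof (rule groupI)
  fix f assume "f \<in> carrier GL_Vstar"
  then have lin: "Vector_Spaces.linear scale scale f" and b: "bij f"
    by (auto simp: GL_Vstar_def)
  interpret f: Vector_Spaces.linear scale scale f by (rule lin)
  let ?g = "inv_into UNIV f"
  have fg: "f (?g z) = z" and gf: "?g (f z) = z" for z
    using b by (simp_all add: bij_is_inj bij_is_surj surj_f_inv_f)
  have "?g (y + z) = ?g y + ?g z" for y z
    by (metis f.add fg gf)
  moreover have "?g (scale c z) = scale c (?g z)" for c z
    by (metis f.scale fg gf)
  ultimately have "Vector_Spaces.linear scale scale ?g"
    by unfold_locales
  then have "?g \<in> carrier GL_Vstar"
    using b by (simp add: GL_Vstar_def bij_imp_bij_inv)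
  moreover have "?g \<otimes>\<^bsub>GL_Vstar\<^esub> f = \<one>\<^bsub>GL_Vstar\<^esub>"
    by (simp add: GL_Vstar_def fun_eq_iff fg)
  ultimately show "\<exists>g\<in>carrier GL_Vstar. g \<otimes>\<^bsub>GL_Vstar\<^esub> f = \<one>\<^bsub>GL_Vstar\<^esub>"
    by blast
next
  show "\<one>\<^bsub>GL_Vstar\<^esub> \<in> carrier GL_Vstar"
    by (auto simp: GL_Vstar_def) (unfold_locales; simp)
qed (auto simp: GL_Vstar_def bij_comp comp_assoc intro: Vector_Spaces.linear_compose)

lemma one_plus_ad_linear: "Vector_Spaces.linear scale scale (one_plus_ad y)"
  by unfold_locales
    (simp_all add: one_plus_ad_def ad_def Vstar_prod_def bilinear_ext_linear algebra_simps)

lemma Vstar_induct: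
  assumes "P 0" "\<And>y z. P y \<Longrightarrow> P z \<Longrightarrow> P (y + z)" "\<And>i. P (bas i)"
  shows "P (z :: Vstar)"
proof -
  have "P (\<Sum>i\<in>I. bas i)" if "finite I" for I
    using that assms by (induction I) auto
  moreover have "z = (\<Sum>i\<in>Poly_Mapping.keys z. bas i)"
    by (rule poly_mapping_eqI) (simp add: lookup_sum lookup_single when_def in_keys_iff)
  ultimately show ?thesis
    by (metis finite_keys)
qed

lemma V_prod_W_sub: "V_prod (bas (of_W i)) (bas j) \<in> W_sub" "V_prod (bas j) (bas (of_W i)) \<in> W_sub"
  by (cases i; cases j rule: V_index_cases;
      simp add: V_prod_def W_sub_def lookup_single)+

lemma bas_W_sub: "bas (of_W i) \<in> W_sub"
  by (simp add: W_sub_def lookup_single)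

lemma set_of_ne: "set_of A \<noteq> {}"
  using set_of[of A] by simp

lemma bas_Copy: "bas (Copy i A) = copy (bas (of_W i)) (set_of A)"
  by (simp add: copy_bas set_of_ne set_of_inverse)

lemma Vstar_prod_zero: "Vstar_prod 0 z = 0"
  by (simp add: Vstar_prod_def)

lemma ad_square_zero: "Vstar_prod (Vstar_prod z (bas i)) (bas i) = 0"
proof (induction z rule: Vstar_induct)
  case (3 k)
  show ?case
  proof (cases i)
    case Xs
    show ?thesis
    proof (cases k)
      case (Copy p C)
      then show ?thesis
        by (cases p) (simp_all add: Xs bas_Copy Vstar_prod_copy_x bas_W_sub set_of_ne V_prod_table
            Vstar_prod_zero)
    qed (simp add: Xs Vstar_prod_def)
  next
    case i: (Copy q D)
    have self: "A \<union> set_of D \<squnion>\<^sub>d set_of D = {}" for A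
      using set_of_ne[of D] by (auto simp: sq_union_def)
    show ?thesis
    proof (cases k)
      case Xs
      have "Vstar_prod (bas k) (bas i) = copy (V_prod xV (bas (of_W q))) (set_of D)"
        by (simp add: Xs i Vstar_prod_def)
      then show ?thesis
        using self[of "{}"]
        by (simp add: i bas_Copy Vstar_prod_copy V_prod_W_sub bas_W_sub set_of_ne)
    next
      case (Copy p C)
      show ?thesis
      proof (cases "set_of C \<inter> set_of D = {}")
        case True
        then have "set_of C \<squnion>\<^sub>d set_of D = set_of C \<union> set_of D"
          by (simp add: sq_union_def)
        then show ?thesis
          by (simp add: Copy i bas_Copy Vstar_prod_copy V_prod_W_sub bas_W_sub set_of_ne self)
      next
        case False
        then have "set_of C \<squnion>\<^sub>d set_of D = {}"
          by (simp add: sq_union_def)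
        then have "Vstar_prod (bas k) (bas i) = 0"
          by (simp add: Copy i bas_Copy Vstar_prod_copy bas_W_sub set_of_ne)
        then show ?thesis
          by (simp add: Vstar_prod_def)
      qed
    qed
  qed
qed (simp_all add: Vstar_prod_def bilinear_ext_linear)

lemma one_plus_ad_bas:
  "one_plus_ad (bas i) \<circ> one_plus_ad (bas i) = id" "one_plus_ad (bas i) \<in> carrier GL_Vstar"
proof -
  have "one_plus_ad (bas i) (one_plus_ad (bas i) z) = z" for z
  proof -
    let ?p = "Vstar_prod z (bas i)"
    have "one_plus_ad (bas i) (one_plus_ad (bas i) z) = z + ?p + (?p + Vstar_prod ?p (bas i))"
      by (simp add: one_plus_ad_def ad_def Vstar_prod_def bilinear_ext_linear)
    also have "\<dots> = z + (?p + ?p)"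
      by (simp only: ad_square_zero add.assoc add_0_right)
    finally show ?thesis by simp
  qed
  then show inv: "one_plus_ad (bas i) \<circ> one_plus_ad (bas i) = id"
    by (simp add: fun_eq_iff)
  have "bij (one_plus_ad (bas i))"
    using o_bij[OF inv inv] .
  then show "one_plus_ad (bas i) \<in> carrier GL_Vstar"
    by (simp add: GL_Vstar_def one_plus_ad_linear)
qed

lemma one_plus_ad_copy_bas:
  "A \<noteq> {} \<Longrightarrow> one_plus_ad (copy (bas (of_W i)) A) \<in> carrier GL_Vstar"
  by (simp add: copy_bas one_plus_ad_bas)

lemma generate_copy_subset:
  "generate GL_Vstar {one_plus_ad (copy (bas (of_W i)) A) | A. A \<noteq> {}} \<subseteq> carrier GL_Vstar"
proof (rule group.generate_incl[OF group_GL_Vstar], rule subsetI)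
  fix f assume "f \<in> {one_plus_ad (copy (bas (of_W i)) A) | A. A \<noteq> {}}"
  then obtain A where "f = one_plus_ad (copy (bas (of_W i)) A)" "A \<noteq> {}"
    by (elim CollectE exE conjE)
  then show "f \<in> carrier GL_Vstar"
    by (simp only: one_plus_ad_copy_bas not_False_eq_True)
qed

lemma UVW_grp_subset:
  "U_grp \<subseteq> carrier GL_Vstar" "V_grp \<subseteq> carrier GL_Vstar" "W_grp \<subseteq> carrier GL_Vstar"
  unfolding U_grp_def V_grp_def W_grp_def by (rule generate_copy_subset)+

lemma group_G_grp: "group G_grp"
  unfolding G_grp_def
  by (rule subgroup.subgroup_is_group[OF group.generate_is_subgroup[OF group_GL_Vstar] group_GL_Vstar])
    (use UVW_grp_subset one_plus_ad_bas(2) in auto)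

lemma one_plus_ad_x_in_G: "one_plus_ad x_star \<in> carrier G_grp"
  by (simp add: G_grp_def generate.incl)

end

theory Submission
  imports Defs
begin

text \<open>
  Write \<open>a = 1 + ad(x)\<close>. Each generator of \<open>G\<close> is \<open>1 + D\<close> for a derivation \<open>D = ad(e)\<close>, \<open>e\<close> a basis
  vector, such that \<open>D(y) D(z) = 0\<close> for all \<open>y\<close> and \<open>z\<close>. Hence it is an automorphism of the algebra
  \<open>V*\<close>, and so is every element of \<open>G\<close> (\<open>G_grp_subset_Aut\<close>). Therefore conjugation acts on operators
  \<open>1 + ad(y)\<close> through their argument: \<open>(1 + ad(y))\<^sup>g = 1 + ad(y g)\<close> (\<open>conjugate_one_plus_ad\<close>).

  \<^emph>\<open>The Engel condition.\<close> Since \<open>a\<close> is an involution, it inverts \<open>[g,a] = a\<^sup>g a\<close>, and the threefold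
  commutator \<open>[g,a,a,a]\<close> is \<open>(a\<^sup>g a)^4\<close>. Put \<open>X = ad(x)\<close> and \<open>Y = ad(x g)\<close>, so that \<open>a\<^sup>g = 1 + Y\<close>
  and \<open>X\<^sup>2 = Y\<^sup>2 = 0\<close>. The image of \<open>X\<close> is spanned by the \<open>u_A\<close>; multiplication by any element of \<open>V*\<close> takes
  this span into the span of the \<open>u_A\<close> and \<open>v_A\<close>, which \<open>X\<close> kills. Thus \<open>X Y X = 0\<close> (\<open>ad_x_sandwich\<close>),
  so \<open>a a\<^sup>g a = 1 + Y + X Y + Y X\<close>. This commutes with \<open>Y\<close>, because both products are equal to
  \<open>Y X Y\<close>. Two involutions \<open>a\<close>, \<open>b\<close> for which \<open>a b a\<close> commutes with \<open>b\<close> satisfy \<open>(b a)^4 = 1\<close>.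

  \<^emph>\<open>The normal closure \<open>N\<close>.\<close> If \<open>e\<close>, \<open>f\<close> are basis vectors whose product \<open>e f\<close> is a basis vector, then
  conjugating \<open>1 + ad(e)\<close> by \<open>1 + ad(f)\<close> gives \<open>1 + ad(e + e f)\<close>, and the commutator of the two is
  \<open>1 + ad(e f)\<close> as soon as \<open>ad(e) ad(e f) = 0\<close> (\<open>commutator_one_plus_ad\<close>). So group commutators imitate
  the products \<open>x \<cdot> w = u\<close>, \<open>u \<cdot> w = v\<close> and \<open>u \<cdot> v = u\<close>. From the first, \<open>N\<close> contains all
  \<open>1 + ad(u_A)\<close>; from the second, it contains \<open>1 + ad(v_B)\<close> whenever \<open>B\<close> has at least two elements. The third
  then shows that commutation with elements of \<open>N\<close> enlarges the set \<open>A\<close> in \<open>1 + ad(u_A)\<close> by any two new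
  numbers. As \<open>\<nat>\<close> is infinite this never stops, and with \<open>A\<close> finite the result is never the identity.
\<close>

section \<open>Involutions, commutators and normal closures\<close>

text \<open>With \<open>b = a\<^sup>g\<close> the iterated commutators are \<open>[g,a] = b a\<close>, \<open>[g,a,a] = (a b)\<^sup>2\<close> and
  \<open>[g,a,a,a] = (b a)^4\<close>. The hypothesis says \<open>(a b)\<^sup>2 = (b a)\<^sup>2\<close>, and these two elements are inverse to each
  other.\<close>

lemma (in group) left_3_Engel_involution:
  assumes a: "a \<in> carrier G" "a \<otimes> a = \<one>"
    and comm: "\<And>g. g \<in> carrier G \<Longrightarrow>
      (let b = inv g \<otimes> a \<otimes> g in (a \<otimes> b \<otimes> a) \<otimes> b = b \<otimes> (a \<otimes> b \<otimes> a))"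
  shows "left_Engel 3 G a"
proof -
  have "((\<lambda>z. commutator G z a) ^^ 3) g = \<one>" if g: "g \<in> carrier G" for g
  proof -
    define b where "b = inv g \<otimes> a \<otimes> g"
    have b: "b \<in> carrier G" using a g by (simp add: b_def)
    have aa: "a \<otimes> (a \<otimes> z) = z" if "z \<in> carrier G" for z
      using a that by (simp flip: m_assoc)
    have ia: "inv a = a" using a by (simp add: inv_equality)
    have bb: "b \<otimes> b = \<one>"
      using a g aa[of g] inv_solve_left[of "a \<otimes> g" g "a \<otimes> g"]
      by (simp add: b_def m_assoc) (simp flip: m_assoc add: aa)
    then have bb': "b \<otimes> (b \<otimes> z) = z" if "z \<in> carrier G" for z
      using b that by (simp flip: m_assoc)
    have ib: "inv b = b" using b bb by (simp add: inv_equality)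
    have c1: "commutator G g a = b \<otimes> a"
      using a g by (simp add: commutator_def b_def ia m_assoc)
    have c2: "commutator G (b \<otimes> a) a = a \<otimes> b \<otimes> a \<otimes> b"
      using a b by (simp add: commutator_def inv_mult_group ia ib m_assoc)
    have ba: "b \<otimes> (a \<otimes> (b \<otimes> a)) = a \<otimes> (b \<otimes> (a \<otimes> b))"
      using comm[OF g] a b by (simp add: Let_def m_assoc flip: b_def)
    have "commutator G (a \<otimes> b \<otimes> a \<otimes> b) a = (b \<otimes> (a \<otimes> (b \<otimes> a))) \<otimes> (b \<otimes> (a \<otimes> (b \<otimes> a)))"
      using a b by (simp add: commutator_def inv_mult_group ia ib m_assoc aa)
    also have "\<dots> = (b \<otimes> (a \<otimes> (b \<otimes> a))) \<otimes> (a \<otimes> (b \<otimes> (a \<otimes> b)))"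
      by (simp only: ba)
    also have "\<dots> = \<one>"
      using a b by (simp add: m_assoc aa bb bb')
    finally show ?thesis
      by (simp add: numeral_3_eq_3 c1 c2)
  qed
  then show ?thesis using a by (simp add: left_Engel_def)
qed

lemma (in group) normal_closure_normal:
  assumes "S \<subseteq> carrier G"
  shows "normal_closure G S \<lhd> G"
  unfolding normal_closure_def
proof (rule normal_generateI)
  show "{inv g \<otimes> s \<otimes> g | s g. s \<in> S \<and> g \<in> carrier G} \<subseteq> carrier G"
    using assms by auto
  fix t h assume t: "t \<in> {inv g \<otimes> s \<otimes> g | s g. s \<in> S \<and> g \<in> carrier G}" and h: "h \<in> carrier G"
  then obtain s g where "t = inv g \<otimes> s \<otimes> g" "s \<in> S" and g: "g \<in> carrier G" by blast
  then have "h \<otimes> t \<otimes> inv h = inv (g \<otimes> inv h) \<otimes> s \<otimes> (g \<otimes> inv h)"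
    using h assms by (simp add: inv_mult_group m_assoc subset_iff)
  then show "h \<otimes> t \<otimes> inv h \<in> {inv g \<otimes> s \<otimes> g | s g. s \<in> S \<and> g \<in> carrier G}"
    using \<open>s \<in> S\<close> g h by blast
qed

lemma (in group) subset_normal_closure:
  assumes "S \<subseteq> carrier G"
  shows "S \<subseteq> normal_closure G S"
proof
  fix s assume "s \<in> S"
  then have "s = inv \<one> \<otimes> s \<otimes> \<one>" using assms by auto
  then show "s \<in> normal_closure G S"
    unfolding normal_closure_def using \<open>s \<in> S\<close> by (blast intro: generate.incl)
qed

lemma (in normal) commutator_in_normal:
  assumes "n \<in> H" "g \<in> carrier G"
  shows "commutator G n g \<in> H"
proof -
  have "commutator G n g = inv n \<otimes> (inv g \<otimes> n \<otimes> g)"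
    using assms by (simp add: commutator_def m_assoc)
  then show ?thesis using assms by (simp add: inv_op_closed1)
qed

lemma (in group) commutator_subgroup:
  assumes "subgroup H G" "a \<in> H" "b \<in> H"
  shows "commutator (G\<lparr>carrier := H\<rparr>) a b = commutator G a b"
  using assms by (simp add: commutator_def m_inv_consistent)

section \<open>Products of basis vectors\<close>

lemma bit_add_cancel: "z + (z + y) = (y :: 'i \<Rightarrow>\<^sub>0 bit)"
  by (simp flip: add.assoc)

text \<open>Giving \<open>x\<close> the empty set as its support makes all products of basis vectors obey one rule: the supports
  must be disjoint, their union is the new support, and the types multiply in \<open>V\<close>. Identities in \<open>V*\<close> then
  reduce to finitely many identities in \<open>V\<close>.\<close>

primrec supp :: "Vstar_index \<Rightarrow> nat set" where
  "supp Xs = {}"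
| "supp (Copy i A) = set_of A"

primrec type_of :: "Vstar_index \<Rightarrow> V_index" where
  "type_of Xs = X_i"
| "type_of (Copy i A) = of_W i"

lemma bas_prod:
  "Vstar_prod (bas i) (bas j) =
     (if supp i \<inter> supp j = {} then copy (V_table (type_of i) (type_of j)) (supp i \<union> supp j) else 0)"
  by (cases i; cases j) (auto simp: Vstar_prod_def V_prod_def sq_union_def)

lemma copy_prod_bas:
  assumes "z \<in> W_sub" "A \<noteq> {}"
  shows "Vstar_prod (copy z A) (bas j) =
    (if A \<inter> supp j = {} then copy (V_prod z (bas (type_of j))) (A \<union> supp j) else 0)"
proof (cases j)
  case Xs
  then show ?thesis using assms by (simp add: Vstar_prod_copy_x)
next
  case (Copy q B)
  then show ?thesis using assms
    by (simp add: bas_Copy Vstar_prod_copy bas_W_sub set_of_ne sq_union_def)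
qed

lemma V_table_W_sub: "V_table i j \<in> W_sub"
  by (cases i rule: V_index_cases; cases j rule: V_index_cases; simp add: W_sub_def lookup_single)

lemma V_prod_W_sub_left: "z \<in> W_sub \<Longrightarrow> V_prod z (bas j) \<in> W_sub"
  by (erule W_sub_cases, cases j rule: V_index_cases)
    (auto simp: V_prod_def bilinear_ext_linear W_sub_def lookup_add scale_lookup lookup_single)

lemma supp_empty_iff: "supp i = {} \<longleftrightarrow> i = Xs"
  by (cases i) (simp_all add: set_of_ne)

lemma bas_prod_bas:
  "Vstar_prod (Vstar_prod (bas i) (bas j)) (bas k) =
     (if supp i \<inter> supp j = {} \<and> (supp i \<union> supp j) \<inter> supp k = {}
      then copy (V_prod (V_table (type_of i) (type_of j)) (bas (type_of k))) (supp i \<union> supp j \<union> supp k)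
      else 0)"
proof (cases "supp i \<union> supp j = {}")
  case True
  then have "i = Xs" "j = Xs" by (simp_all add: supp_empty_iff)
  then show ?thesis by (simp add: bas_prod Vstar_prod_zero V_prod_def)
next
  case False
  then show ?thesis by (simp add: bas_prod Vstar_prod_zero copy_prod_bas V_table_W_sub)
qed

lemma Vstar_prod_linear:
  "Vstar_prod (y + y') z = Vstar_prod y z + Vstar_prod y' z"
  "Vstar_prod y (z + z') = Vstar_prod y z + Vstar_prod y z'"
  "Vstar_prod 0 z = 0" "Vstar_prod y 0 = 0"
  by (simp_all add: Vstar_prod_def bilinear_ext_linear)

lemma Vstar_prod_commute: "Vstar_prod y z = Vstar_prod z y"
proof (induction y rule: Vstar_induct)
  case (3 i)
  show ?case
    by (induction z rule: Vstar_induct)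
       (simp_all add: Vstar_prod_linear, simp add: Vstar_prod_def Vstar_table_alternating(2))
qed (simp_all add: Vstar_prod_linear)

text \<open>This is the Jacobi identity of \<open>V\<close>; no signs occur in characteristic \<open>2\<close>.\<close>

lemma V_derivation:
  "V_prod (V_table i j) (bas k) = V_prod (V_table i k) (bas j) + V_prod (V_table j k) (bas i)"
  by (cases i rule: V_index_cases; cases j rule: V_index_cases; cases k rule: V_index_cases)
     (simp_all add: V_prod_def)

lemma bas_derivation:
  "Vstar_prod (Vstar_prod (bas i) (bas j)) (bas k) =
   Vstar_prod (Vstar_prod (bas i) (bas k)) (bas j) + Vstar_prod (Vstar_prod (bas j) (bas k)) (bas i)"
  unfolding bas_prod_bas
  by (auto simp: V_derivation[of "type_of i" "type_of j"] copy_add Un_ac Int_commute)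

text \<open>It is this vanishing that makes the ideal spanned by the \<open>z_B\<close> with
  \<open>A \<subseteq> B\<close>, for a fixed nonempty \<open>A\<close>, abelian.\<close>

lemma Vstar_prod_overlap:
  assumes "z \<in> W_sub" "t \<in> W_sub" "A \<inter> B \<noteq> {}"
  shows "Vstar_prod (copy z A) (copy t B) = 0"
proof -
  have "A \<noteq> {}" "B \<noteq> {}" using assms(3) by auto
  then show ?thesis using assms by (simp add: Vstar_prod_copy sq_union_def)
qed

lemma V_x_image_abelian: "V_prod (V_table i X_i) (V_table j X_i) = 0"
  by (cases i rule: V_index_cases; cases j rule: V_index_cases) (simp_all add: V_prod_def)

text \<open>Multiplication by \<open>x\<close> takes everything into the span of the \<open>u_A\<close>, which is abelian since \<open>u \<cdot> u = 0\<close>;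
  multiplication by a basis vector with support \<open>A\<close> takes everything into the abelian ideal of elements whose
  supports contain \<open>A\<close>.\<close>

lemma bas_ad_image_abelian:
  "Vstar_prod (Vstar_prod (bas i) (bas k)) (Vstar_prod (bas j) (bas k)) = 0"
proof (cases k)
  case Xs
  show ?thesis
  proof (cases "supp i = {} \<or> supp j = {}")
    case True
    then show ?thesis by (auto simp: supp_empty_iff Xs bas_prod Vstar_prod_linear)
  next
    case False
    then show ?thesis
      by (simp add: Xs bas_prod Vstar_prod_copy V_table_W_sub V_x_image_abelian)
  qed
next
  case (Copy q A)
  then have "supp k \<noteq> {}" by (simp add: set_of_ne)
  then show ?thesis
    by (auto simp: bas_prod Vstar_prod_linear intro!: Vstar_prod_overlap V_table_W_sub)
qed

lemma ad_bas_derivation: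
  "Vstar_prod (Vstar_prod y z) (bas k) =
   Vstar_prod (Vstar_prod y (bas k)) z + Vstar_prod y (Vstar_prod z (bas k))"
proof (induction y rule: Vstar_induct)
  case (3 i)
  show ?case
  proof (induction z rule: Vstar_induct)
    case (3 j)
    show ?case
      using bas_derivation[of i j k] Vstar_prod_commute[of "bas i" "Vstar_prod (bas j) (bas k)"]
      by simp
  qed (simp_all add: Vstar_prod_linear algebra_simps)
qed (simp_all add: Vstar_prod_linear algebra_simps)

lemma ad_bas_image_abelian:
  "Vstar_prod (Vstar_prod y (bas k)) (Vstar_prod z (bas k)) = 0"
proof (induction y rule: Vstar_induct)
  case (3 i)
  show ?case
    by (induction z rule: Vstar_induct) (simp_all add: Vstar_prod_linear bas_ad_image_abelian)
qed (simp_all add: Vstar_prod_linear)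

text \<open>The first factor \<open>x\<close> leads into the span of the \<open>u_A\<close>. As \<open>u \<cdot> u = u \<cdot> x = 0\<close>, \<open>u \<cdot> v = u\<close> and
  \<open>u \<cdot> w = v\<close>, the factor \<open>z\<close> leads from there only to combinations of the \<open>u_A\<close> and \<open>v_A\<close>, and \<open>x\<close> annihilates
  these.\<close>

lemma ad_x_sandwich:
  "Vstar_prod (Vstar_prod (Vstar_prod y x_star) z) x_star = 0"
proof (induction y rule: Vstar_induct)
  case (3 i)
  have V: "V_prod (V_prod (V_table r X_i) (bas s)) xV = 0" for r s
    by (cases r rule: V_index_cases; cases s rule: V_index_cases) (simp_all add: V_prod_def)
  show ?case
  proof (induction z rule: Vstar_induct)
    case (3 j)
    show ?case
    proof (cases "supp i \<union> supp j = {}")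
      case True
      then have "i = Xs" by (simp add: supp_empty_iff)
      then show ?thesis by (simp add: bas_prod Vstar_prod_linear)
    next
      case False
      then show ?thesis
        by (simp add: bas_prod_bas Vstar_prod_linear copy_prod_bas V_prod_W_sub_left V_table_W_sub V)
    qed
  qed (simp_all add: Vstar_prod_linear)
qed (simp_all add: Vstar_prod_linear)

lemma ad_overlap:
  assumes "supp j \<inter> supp k \<noteq> {}"
  shows "Vstar_prod (Vstar_prod z (bas j)) (bas k) = 0"
  using assms
  by (induction z rule: Vstar_induct) (auto simp: Vstar_prod_linear bas_prod_bas)

section \<open>Automorphisms\<close>

definition Aut_Vstar :: "(Vstar \<Rightarrow> Vstar) set" where
  "Aut_Vstar = {f \<in> carrier GL_Vstar. \<forall>y z. f (Vstar_prod y z) = Vstar_prod (f y) (f z)}"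

text \<open>For a derivation \<open>D\<close> the map \<open>1 + D\<close> fails to be multiplicative only by the term \<open>D(y) D(z)\<close>.\<close>

lemma one_plus_ad_bas_automorphism: "one_plus_ad (bas i) \<in> Aut_Vstar"
proof -
  have "one_plus_ad (bas i) (Vstar_prod y z) =
      Vstar_prod (one_plus_ad (bas i) y) (one_plus_ad (bas i) z)" for y z
    by (simp add: one_plus_ad_def ad_def Vstar_prod_linear
        ad_bas_derivation ad_bas_image_abelian algebra_simps)
  then show ?thesis by (simp add: Aut_Vstar_def one_plus_ad_bas)
qed

lemma subgroup_Aut_Vstar: "subgroup Aut_Vstar GL_Vstar"
proof -
  interpret GL: group GL_Vstar by (rule group_GL_Vstar)
  have mult: "f \<otimes>\<^bsub>GL_Vstar\<^esub> g = g \<circ> f" and one: "\<one>\<^bsub>GL_Vstar\<^esub> = id" for f g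
    by (simp_all add: GL_Vstar_def)
  show ?thesis
  proof (rule GL.subgroupI)
    show "Aut_Vstar \<subseteq> carrier GL_Vstar" by (auto simp: Aut_Vstar_def)
    show "Aut_Vstar \<noteq> {}" using one_plus_ad_bas_automorphism by blast
    fix f assume f: "f \<in> Aut_Vstar"
    let ?g = "inv\<^bsub>GL_Vstar\<^esub> f"
    have c: "f \<in> carrier GL_Vstar" using f by (simp add: Aut_Vstar_def)
    have "f (?g z) = z" "?g (f z) = z" for z
      using GL.l_inv[OF c] GL.r_inv[OF c] by (simp_all add: mult one fun_eq_iff)
    then have "?g (Vstar_prod y z) = Vstar_prod (?g y) (?g z)" for y z
      using f unfolding Aut_Vstar_def by (metis (mono_tags, lifting) mem_Collect_eq)
    then show "?g \<in> Aut_Vstar" using c by (simp add: Aut_Vstar_def)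
  next
    fix f g assume "f \<in> Aut_Vstar" "g \<in> Aut_Vstar"
    then show "f \<otimes>\<^bsub>GL_Vstar\<^esub> g \<in> Aut_Vstar"
      using GL.m_closed[of f g] by (simp add: Aut_Vstar_def mult)
  qed
qed

lemma one_plus_ad_copy_automorphism:
  "A \<noteq> {} \<Longrightarrow> one_plus_ad (copy (bas (of_W i)) A) \<in> Aut_Vstar"
  by (simp add: copy_bas one_plus_ad_bas_automorphism)

lemma G_grp_subset_Aut: "carrier G_grp \<subseteq> Aut_Vstar"
proof -
  have "{one_plus_ad (copy (bas (of_W i)) A) | A. A \<noteq> {}} \<subseteq> Aut_Vstar" for i
  proof
    fix f assume "f \<in> {one_plus_ad (copy (bas (of_W i)) A) | A. A \<noteq> {}}"
    then obtain A where "f = one_plus_ad (copy (bas (of_W i)) A)" "A \<noteq> {}" by (elim CollectE exE conjE)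
    then show "f \<in> Aut_Vstar" by (simp only: one_plus_ad_copy_automorphism not_False_eq_True)
  qed
  note * = group.generate_subgroup_incl[OF group_GL_Vstar this subgroup_Aut_Vstar]
  have "U_grp \<subseteq> Aut_Vstar" "V_grp \<subseteq> Aut_Vstar" "W_grp \<subseteq> Aut_Vstar"
    unfolding U_grp_def V_grp_def W_grp_def by (rule *)+
  then show ?thesis
    unfolding G_grp_def
    using group.generate_subgroup_incl[OF group_GL_Vstar _ subgroup_Aut_Vstar]
      one_plus_ad_bas_automorphism by simp
qed

interpretation G: group G_grp by (rule group_G_grp)

lemma mult_G_grp [simp]: "f \<otimes>\<^bsub>G_grp\<^esub> g = g \<circ> f" and one_G_grp [simp]: "\<one>\<^bsub>G_grp\<^esub> = id"
  by (simp_all add: G_grp_def GL_Vstar_def)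

lemma one_plus_ad_in_G: "one_plus_ad (bas i) \<in> carrier G_grp"
proof (cases i)
  case Xs
  then show ?thesis using one_plus_ad_x_in_G by simp
next
  case (Copy p A)
  define S where "S q = generate GL_Vstar {one_plus_ad (copy (bas (of_W q)) A) | A. A \<noteq> {}}" for q
  have "one_plus_ad (bas i) \<in> S p"
    unfolding S_def Copy bas_Copy using set_of_ne by (blast intro: generate.incl)
  moreover have "S p \<subseteq> U_grp \<union> V_grp \<union> W_grp"
    by (cases p) (auto simp: S_def U_grp_def V_grp_def W_grp_def)
  ultimately show ?thesis
    by (auto simp: G_grp_def intro: generate.incl)
qed

lemma inv_one_plus_ad: "inv\<^bsub>G_grp\<^esub> (one_plus_ad (bas i)) = one_plus_ad (bas i)"
  by (rule G.inv_equality) (simp_all add: one_plus_ad_bas one_plus_ad_in_G)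

lemma conjugate_one_plus_ad:
  assumes "g \<in> carrier G_grp"
  shows "inv\<^bsub>G_grp\<^esub> g \<otimes>\<^bsub>G_grp\<^esub> one_plus_ad y \<otimes>\<^bsub>G_grp\<^esub> g = one_plus_ad (g y)"
proof
  fix z
  have g: "g (Vstar_prod s t) = Vstar_prod (g s) (g t)" for s t
    using assms G_grp_subset_Aut by (auto simp: Aut_Vstar_def)
  interpret g: Vector_Spaces.linear scale scale g
    using assms G_grp_subset_Aut by (auto simp: Aut_Vstar_def GL_Vstar_def)
  have "g ((inv\<^bsub>G_grp\<^esub> g) z) = z"
    using G.l_inv[OF assms] by (simp add: fun_eq_iff)
  then show "(inv\<^bsub>G_grp\<^esub> g \<otimes>\<^bsub>G_grp\<^esub> one_plus_ad y \<otimes>\<^bsub>G_grp\<^esub> g) z = one_plus_ad (g y) z"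
    by (simp add: one_plus_ad_def ad_def g g.add)
qed

section \<open>The Engel condition\<close>

lemma left_Engel_one_plus_ad_x: "left_Engel 3 G_grp (one_plus_ad x_star)"
proof (rule G.left_3_Engel_involution)
  show "one_plus_ad x_star \<in> carrier G_grp" by (rule one_plus_ad_x_in_G)
  show "one_plus_ad x_star \<otimes>\<^bsub>G_grp\<^esub> one_plus_ad x_star = \<one>\<^bsub>G_grp\<^esub>"
    by (simp add: one_plus_ad_bas)
  fix g assume g: "g \<in> carrier G_grp"
  let ?a = "one_plus_ad x_star" and ?b = "one_plus_ad (g x_star)"
  \<comment> \<open>With \<open>X\<close>, \<open>Y\<close> the two \<open>ad\<close> operators, this is \<open>1 + Y + Y X + X Y\<close>; the term \<open>X Y X\<close> has vanished.\<close>
  have aba: "?a (?b (?a z)) = z + Vstar_prod z (g x_star)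
      + Vstar_prod (Vstar_prod z (g x_star)) x_star + Vstar_prod (Vstar_prod z x_star) (g x_star)" for z
    using ad_square_zero[of z Xs] ad_x_sandwich[of z "g x_star"]
    by (simp add: one_plus_ad_def ad_def Vstar_prod_linear bit_add_cancel algebra_simps)
  \<comment> \<open>\<open>Y\<close> is conjugate to \<open>X\<close>, so its square is zero as well.\<close>
  have gg: "Vstar_prod (Vstar_prod z (g x_star)) (g x_star) = 0" for z
  proof -
    have aut: "g (Vstar_prod s t) = Vstar_prod (g s) (g t)" for s t
      using g G_grp_subset_Aut by (auto simp: Aut_Vstar_def)
    interpret g: Vector_Spaces.linear scale scale g
      using g G_grp_subset_Aut by (auto simp: Aut_Vstar_def GL_Vstar_def)
    obtain y where "z = g y"
      using G.l_inv[OF g] by (force simp: fun_eq_iff dest: sym)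
    then show ?thesis by (simp add: ad_square_zero g.zero flip: aut)
  qed
  have "(?a \<circ> ?b \<circ> ?a) (?b z) = ?b ((?a \<circ> ?b \<circ> ?a) z)" for z
    by (simp add: aba) (simp add: one_plus_ad_def ad_def Vstar_prod_linear gg algebra_simps)
  then show "let b = inv\<^bsub>G_grp\<^esub> g \<otimes>\<^bsub>G_grp\<^esub> ?a \<otimes>\<^bsub>G_grp\<^esub> g
    in (?a \<otimes>\<^bsub>G_grp\<^esub> b \<otimes>\<^bsub>G_grp\<^esub> ?a) \<otimes>\<^bsub>G_grp\<^esub> b = b \<otimes>\<^bsub>G_grp\<^esub> (?a \<otimes>\<^bsub>G_grp\<^esub> b \<otimes>\<^bsub>G_grp\<^esub> ?a)"
    unfolding conjugate_one_plus_ad[OF g] Let_def by (simp add: fun_eq_iff)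
qed

section \<open>The normal closure is not nilpotent\<close>

text \<open>The commutator of \<open>f = 1 + ad(e)\<close> and \<open>h\<close> is the product of \<open>f\<close>, its own inverse, with the conjugate
  \<open>f\<^sup>h = 1 + ad(e h)\<close>, where here \<open>e h = e + e'\<close> with \<open>e'\<close> the product of the two basis vectors. Expanding
  \<open>(1 + ad(e)) (1 + ad(e) + ad(e'))\<close>, the square of \<open>ad(e)\<close> is zero, and the first hypothesis removes the
  remaining mixed term.\<close>

lemma commutator_one_plus_ad:
  assumes "\<And>z. Vstar_prod (Vstar_prod z (bas i)) (bas k) = 0"
    and "Vstar_prod (bas i) (bas j) = bas k"
  shows "commutator G_grp (one_plus_ad (bas i)) (one_plus_ad (bas j)) = one_plus_ad (bas k)"
proof -
  let ?f = "one_plus_ad (bas i)" and ?h = "one_plus_ad (bas j)"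
  have "commutator G_grp ?f ?h = ?f \<otimes>\<^bsub>G_grp\<^esub> (inv\<^bsub>G_grp\<^esub> ?h \<otimes>\<^bsub>G_grp\<^esub> ?f \<otimes>\<^bsub>G_grp\<^esub> ?h)"
    by (simp add: commutator_def inv_one_plus_ad comp_assoc)
  also have "\<dots> = ?f \<otimes>\<^bsub>G_grp\<^esub> one_plus_ad (?h (bas i))"
    by (simp only: conjugate_one_plus_ad one_plus_ad_in_G)
  also have "?h (bas i) = bas i + bas k"
    by (simp add: one_plus_ad_def ad_def assms(2))
  also have "?f \<otimes>\<^bsub>G_grp\<^esub> one_plus_ad (bas i + bas k) = one_plus_ad (bas k)"
  proof
    fix z
    show "(?f \<otimes>\<^bsub>G_grp\<^esub> one_plus_ad (bas i + bas k)) z = one_plus_ad (bas k) z"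
      by (simp add: one_plus_ad_def ad_def Vstar_prod_linear assms(1) ad_square_zero
          bit_add_cancel add.assoc)
  qed
  finally show ?thesis .
qed

text \<open>The square of \<open>ad\<close> of a basis vector is zero, so that \<open>1 + ad\<close> is its exponential.\<close>

definition exp_bas :: "W_index \<Rightarrow> nat set \<Rightarrow> Vstar \<Rightarrow> Vstar" where
  "exp_bas i A = one_plus_ad (bas (Copy i (nonempty_of A)))"

lemma exp_bas_in_G: "exp_bas i A \<in> carrier G_grp"
  by (simp add: exp_bas_def one_plus_ad_in_G)

lemma commutator_exp_bas:
  assumes "A \<noteq> {}" "B \<noteq> {}" "A \<inter> B = {}" "V_table (of_W i) (of_W j) = bas (of_W k)"
  shows "commutator G_grp (exp_bas i A) (exp_bas j B) = exp_bas k (A \<union> B)"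
  unfolding exp_bas_def
  by (rule commutator_one_plus_ad)
     (use assms in \<open>simp_all add: ad_overlap bas_prod copy_bas Int_Un_distrib\<close>)

lemma commutator_x_exp_bas:
  assumes "A \<noteq> {}"
  shows "commutator G_grp (one_plus_ad x_star) (exp_bas W_i A) = exp_bas U_i A"
  unfolding exp_bas_def
proof (rule commutator_one_plus_ad)
  show "Vstar_prod x_star (bas (Copy W_i (nonempty_of A))) = bas (Copy U_i (nonempty_of A))"
    using assms by (simp add: bas_prod copy_bas)
  have V: "V_prod (V_table r X_i) uV = 0" for r
    by (cases r rule: V_index_cases) (simp_all add: V_prod_def)
  show "Vstar_prod (Vstar_prod z x_star) (bas (Copy U_i (nonempty_of A))) = 0" for z
    by (induction z rule: Vstar_induct) (simp_all add: Vstar_prod_linear bas_prod_bas V)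
qed

text \<open>The operator moves \<open>v_D\<close>, where \<open>D = {d}\<close>, to \<open>v_D + u_{A \<union> D}\<close>.\<close>

lemma exp_bas_not_id:
  assumes "A \<noteq> {}" "d \<notin> A"
  shows "exp_bas U_i A \<noteq> id"
proof
  assume "exp_bas U_i A = id"
  then have "Vstar_prod (bas (Copy V_i (nonempty_of {d}))) (bas (Copy U_i (nonempty_of A))) = 0"
    by (metis add_cancel_left_right exp_bas_def one_plus_ad_def ad_def id_apply)
  then have "bas (Copy U_i (nonempty_of ({d} \<union> A))) = (0 :: Vstar)"
    using assms by (simp add: bas_prod copy_bas)
  then show False by (metis lookup_single_eq lookup_zero zero_neq_one)
qed

theorem theorem2p5:
  shows "left_Engel 3 G_grp (one_plus_ad x_star) \<and>
    \<not> nilpotent_group (G_grp\<lparr>carrier := normal_closure G_grp {one_plus_ad x_star}\<rparr>)"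
proof
  show "left_Engel 3 G_grp (one_plus_ad x_star)" by (rule left_Engel_one_plus_ad_x)
  define N where "N = normal_closure G_grp {one_plus_ad x_star}"
  have N: "N \<lhd> G_grp" and x: "one_plus_ad x_star \<in> N"
    using G.normal_closure_normal[of "{one_plus_ad x_star}"]
      G.subset_normal_closure[of "{one_plus_ad x_star}"] one_plus_ad_x_in_G
    by (simp_all add: N_def)
  \<comment> \<open>From \<open>x \<cdot> w_A = u_A\<close>.\<close>
  have U: "exp_bas U_i A \<in> N" if "A \<noteq> {}" for A
    using normal.commutator_in_normal[OF N x exp_bas_in_G[of W_i A]] commutator_x_exp_bas[OF that] by simp
  \<comment> \<open>From \<open>u_A \<cdot> w_B = v_{A \<union> B}\<close>; this is why the supports below grow by two numbers at a time.\<close>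
  have V: "exp_bas V_i (A \<union> B) \<in> N" if "A \<noteq> {}" "B \<noteq> {}" "A \<inter> B = {}" for A B
    using normal.commutator_in_normal[OF N U[OF that(1)] exp_bas_in_G[of W_i B]]
      commutator_exp_bas[OF that, of U_i W_i V_i] by simp
  have gamma: "exp_bas U_i {..2 * n} \<in> lower_central (G_grp\<lparr>carrier := N\<rparr>) n" for n
  proof (induction n)
    case 0
    then show ?case using U[of "{..0}"] by simp
  next
    case (Suc n)
    let ?B = "{2 * n + 1} \<union> {2 * n + 2}"
    have u: "exp_bas U_i {..2 * n} \<in> N" by (rule U) auto
    have v: "exp_bas V_i ?B \<in> N" by (rule V) auto
    have "commutator (G_grp\<lparr>carrier := N\<rparr>) (exp_bas U_i {..2 * n}) (exp_bas V_i ?B)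
        = commutator G_grp (exp_bas U_i {..2 * n}) (exp_bas V_i ?B)"
      by (rule G.commutator_subgroup[OF normal_imp_subgroup[OF N] u v])
    also have "\<dots> = exp_bas U_i ({..2 * n} \<union> ?B)"
      by (rule commutator_exp_bas) auto
    also have "{..2 * n} \<union> ?B = {..2 * Suc n}" by auto
    finally have c: "exp_bas U_i {..2 * Suc n} =
      commutator (G_grp\<lparr>carrier := N\<rparr>) (exp_bas U_i {..2 * n}) (exp_bas V_i ?B)" by simp
    show ?case
      unfolding lower_central.simps c
      by (rule generate.incl) (use Suc v in auto)
  qed
  show "\<not> nilpotent_group (G_grp\<lparr>carrier := normal_closure G_grp {one_plus_ad x_star}\<rparr>)"
  proof
    assume "nilpotent_group (G_grp\<lparr>carrier := normal_closure G_grp {one_plus_ad x_star}\<rparr>)"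
    then obtain n where "lower_central (G_grp\<lparr>carrier := N\<rparr>) n = {id}"
      by (auto simp: nilpotent_group_def N_def)
    then show False
      using gamma[of n] exp_bas_not_id[of "{..2 * n}" "2 * n + 1"] by simp
  qed
qed

end
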